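(* Let $\alpha, \varepsilon\in\mathbb{R}$ be fixed with $\alpha\leq 0$ and $\varepsilon\geq 0$. Suppose that the function $f:[0,1]\rightarrow\mathbb{R}$ satisfies the inequality $$\left|f(x)+(1-x)^{\alpha}f\left(\frac{y}{1-x}\right)-f(y)-(1-y)^{\alpha}f\left(\frac{x}{1-y}\right)\right| \leq \varepsilon$$ for all $(x, y)\in D$. Then: (i) in case $\alpha<0$, there exist $a, b\in\mathbb{R}$ such that the function $h_{1}:[0,1]\to\mathbb{R}$ defined by $$h_{1}(x)=\begin{cases} 0, & \text{if } x=0,\\ ax^{\alpha}+b(1-x)^{\alpha}-b, & \text{if } x\in ]0,1[,\\ a-b, & \text{if } x=1\end{cases}$$ is a solution of the parametric fundamental equation of information on $D$ (with parameter $\alpha$), and $$\left|f(x)-h_{1}(x)\right|\leq 15\varepsilon \quad \text{for all } x\in [0,1];$$ (ii) in case $\alpha=0$, there exist $a, b, c\in\mathbb{R}$ such that the function $h_{2}:[0,1]\to\mathbb{R}$ defined by $$h_{2}(x)=\begin{cases} a, & \text{if } x=0,\\ c, & \text{if } x\in ]0,1[,\\ b, & \text{if } x=1\end{cases}$$ is a solution of the parametric fundamental equation of information on $D$ (with parameter $\alpha=0$), and $$\left|f(x)-h_{2}(x)\right|\leq 63\varepsilon \quad \text{for all } x\in [0,1].$$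
   Context: $[0,1[$ denotes the half-open interval containing $0$ but not $1$, and $]0,1[$ the open unit interval. $D=\{(x, y)\in \mathbb{R}^{2} : x, y \in [0,1[,\ x+y\leq 1\}$. A function $h:[0,1]\to\mathbb{R}$ is a solution of the parametric fundamental equation of information on $D$ with parameter $\alpha$ if $$h(x)+(1-x)^{\alpha}h\left(\frac{y}{1-x}\right)=h(y)+(1-y)^{\alpha}h\left(\frac{x}{1-y}\right)$$ for all $(x,y)\in D$. *)

theory Defs
  imports Complex_Main
begin

definition D :: "(real \<times> real) set" where
  "D = {(x, y). x \<in> {0..<1} \<and> y \<in> {0..<1} \<and> x + y \<le> 1}"

text \<open>Functions on the closed unit interval are represented by total functions on the reals.
  For a point of \<open>D\<close> all arguments of \<open>h\<close> below lie in the closed unit interval and all bases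
  of the powers are positive, so neither junk values of \<open>h\<close> nor of \<open>powr\<close> matter.\<close>

definition fei_solution :: "real \<Rightarrow> (real \<Rightarrow> real) \<Rightarrow> bool" where
  "fei_solution \<alpha> h \<longleftrightarrow>
    (\<forall>(x, y) \<in> D. h x + (1 - x) powr \<alpha> * h (y / (1 - x)) =
                  h y + (1 - y) powr \<alpha> * h (x / (1 - y)))"

definition h1 :: "real \<Rightarrow> real \<Rightarrow> real \<Rightarrow> real \<Rightarrow> real" where
  "h1 \<alpha> a b x =
    (if x = 0 then 0
     else if x = 1 then a - b
     else a * x powr \<alpha> + b * (1 - x) powr \<alpha> - b)"

definition h2 :: "real \<Rightarrow> real \<Rightarrow> real \<Rightarrow> real \<Rightarrow> real" where
  "h2 a b c x = (if x = 0 then a else if x = 1 then b else c)"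

end

theory Submission
  imports Defs
begin

text \<open>
  Put \<open>G z x = (x + z) powr \<alpha> * f (x / (x + z)) - f 1 * x powr \<alpha>\<close>, which is homogeneous of
  degree \<open>\<alpha>\<close>. The hypothesis says that \<open>G\<close> is symmetric and satisfies the cocycle equation
  \<open>G z x + G (z + x) y = G z y + G (z + y) x\<close>, both up to \<open>\<epsilon>\<close> times the total mass to the
  power \<open>\<alpha>\<close>. If \<open>\<alpha> < 0\<close>, both defects satisfy linear identities in which all other terms
  contain a free variable \<open>w\<close> and vanish as \<open>w\<close> tends to infinity; hence both defects are zero.
  Evaluating \<open>G\<close> on the product distribution \<open>(x, y) \<times> (u, v)\<close> by rows and by columns
  compares \<open>G x y * (1 - u powr \<alpha> - v powr \<alpha>)\<close> with
  \<open>G u v * (1 - x powr \<alpha> - y powr \<alpha>)\<close>. For \<open>\<alpha> < 0\<close> this determines \<open>f\<close> exactly, and for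
  \<open>\<alpha> = 0\<close> it says that \<open>f\<close> is constant on the open interval up to \<open>7 * \<epsilon>\<close>.
\<close>

text \<open>If \<open>x\<close>, \<open>y\<close> and \<open>1 - x - y\<close> are positive, both
  sides equal \<open>a * x powr \<alpha> + a * y powr \<alpha> + b * (1 - x - y) powr \<alpha> -
  b\<close>, which is symmetric in \<open>x\<close> and \<open>y\<close>. The value
  \<open>a - b\<close> at 1 yields the same expression without the \<open>1 - x - y\<close> term on
  the edge \<open>x + y = 1\<close>.\<close>

lemma fei_solution_h1: "fei_solution \<alpha> (h1 \<alpha> a b)"
proof -
  have "h1 \<alpha> a b x + (1 - x) powr \<alpha> * h1 \<alpha> a b (y / (1 - x)) =
        h1 \<alpha> a b y + (1 - y) powr \<alpha> * h1 \<alpha> a b (x / (1 - y))"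
    if "0 \<le> x" "x < 1" "0 \<le> y" "y < 1" "x + y \<le> 1" for x y
  proof (cases "x = 0 \<or> y = 0")
    case True
    then show ?thesis by (auto simp: h1_def)
  next
    case False
    then have pos: "0 < x" "0 < y" using that by auto
    show ?thesis
    proof (cases "x + y = 1")
      case True
      then have y: "y = 1 - x" by simp
      show ?thesis using pos unfolding y by (simp add: h1_def algebra_simps)
    next
      case False
      have expand: "(1 - s) powr \<alpha> * h1 \<alpha> a b (t / (1 - s)) =
          a * t powr \<alpha> + b * (1 - s - t) powr \<alpha> - b * (1 - s) powr \<alpha>"
        if "0 < s" "0 < t" "s + t < 1" for s t
      proof -
        have q: "t / (1 - s) \<noteq> 0" "t / (1 - s) \<noteq> 1" using that by auto
        have "1 - t / (1 - s) = (1 - s - t) / (1 - s)" using that by (simp add: field_simps)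
        then have "(1 - t / (1 - s)) powr \<alpha> = (1 - s - t) powr \<alpha> / (1 - s) powr \<alpha>"
          using that by (simp add: powr_divide)
        moreover have "(t / (1 - s)) powr \<alpha> = t powr \<alpha> / (1 - s) powr \<alpha>"
          using that by (simp add: powr_divide)
        ultimately show ?thesis
          using q that by (simp add: h1_def field_simps)
      qed
      have swap: "1 - x - y = 1 - y - x" by simp
      have "x + y < 1" "y + x < 1" using False that by auto
      then have "(1 - x) powr \<alpha> * h1 \<alpha> a b (y / (1 - x)) =
          a * y powr \<alpha> + b * (1 - y - x) powr \<alpha> - b * (1 - x) powr \<alpha>"
        and "(1 - y) powr \<alpha> * h1 \<alpha> a b (x / (1 - y)) =
          a * x powr \<alpha> + b * (1 - y - x) powr \<alpha> - b * (1 - y) powr \<alpha>"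
        using expand[of x y] expand[of y x] pos unfolding swap by blast+
      then show ?thesis
        using pos that unfolding h1_def[of _ _ _ x] h1_def[of _ _ _ y] by simp
    qed
  qed
  then show ?thesis unfolding fei_solution_def D_def by auto
qed

lemma fei_solution_h2: "fei_solution 0 (h2 a b c)"
proof -
  have "h2 a b c x + (1 - x) powr 0 * h2 a b c (y / (1 - x)) =
        h2 a b c y + (1 - y) powr 0 * h2 a b c (x / (1 - y))"
    if "0 \<le> x" "x < 1" "0 \<le> y" "y < 1" "x + y \<le> 1" for x y
    using that by (auto simp: h2_def field_simps)
  then show ?thesis unfolding fei_solution_def D_def by auto
qed

lemma eq_0_if_abs_le_powr:
  fixes c K \<alpha> :: real
  assumes "\<alpha> < 0" and le: "\<And>w. 0 < w \<Longrightarrow> \<bar>c\<bar> \<le> K * w powr \<alpha>"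
  shows "c = 0"
proof -
  have "((\<lambda>w. K * w powr \<alpha>) \<longlongrightarrow> K * 0) at_top"
    by (intro tendsto_mult tendsto_const tendsto_neg_powr[OF \<open>\<alpha> < 0\<close>] filterlim_ident)
  moreover have "\<forall>\<^sub>F w in at_top. \<bar>c\<bar> \<le> K * w powr \<alpha>"
    using eventually_gt_at_top[of 0] by eventually_elim (rule le)
  ultimately have "\<bar>c\<bar> \<le> K * 0"
    by (intro tendsto_lowerbound) auto
  then show ?thesis by simp
qed

text \<open>The uniform bound \<open>\<delta>\<close> lets this serve both signs: it is 0 once the
  defects are known to vanish for \<alpha> < 0, and \<open>\<epsilon>\<close> for \<alpha> = 0,
  where the weights are 1.\<close>

lemma product_rule_defect:
  fixes G :: "real \<Rightarrow> real \<Rightarrow> real"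
  assumes sym: "\<And>x z. 0 < x \<Longrightarrow> 0 < z \<Longrightarrow> \<bar>G z x - G x z\<bar> \<le> \<delta>"
    and coc: "\<And>x y z. 0 < x \<Longrightarrow> 0 < y \<Longrightarrow> 0 < z \<Longrightarrow>
      \<bar>G z x + G (z + x) y - G z y - G (z + y) x\<bar> \<le> \<delta>"
    and hom: "\<And>t x z. 0 < t \<Longrightarrow> 0 < x \<Longrightarrow> 0 < z \<Longrightarrow> G (t * z) (t * x) = t powr \<alpha> * G z x"
    and pos: "0 < x" "0 < y" "0 < u" "0 < v" and sums: "x + y = 1" "u + v = 1"
  shows "\<bar>G x y * (1 - u powr \<alpha> - v powr \<alpha>) - G u v * (1 - x powr \<alpha> - y powr \<alpha>)\<bar> \<le> 7 * \<delta>"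
proof -
  \<comment> \<open>Merging \<open>c\<close> with \<open>d\<close> first is traded for adding
    \<open>c\<close>, then \<open>d\<close>, to \<open>a + b\<close>: one cocycle step and two
    swaps.\<close>
  have regroup: "\<bar>G c d + G (a + b) (c + d) - G (a + b) c - G (a + b + c) d\<bar> \<le> 3 * \<delta>"
    if "0 < a" "0 < b" "0 < c" "0 < d" for a b c d
    using sym[of "c + d" "a + b"] coc[of d "a + b" c] sym[of c "a + b"] that
    by (simp add: add.commute add.left_commute)
  \<comment> \<open>Rows and columns of the table \<open>a b / c d\<close> are both regrouped, at
    cost 3 each; the two chains then differ only in the order of \<open>b\<close> and
    \<open>c\<close>, one more cocycle step.\<close>
  have "\<bar>(G a b + G c d + G (a + b) (c + d)) - (G a c + G b d + G (a + c) (b + d))\<bar> \<le> 7 * \<delta>"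
    if "0 < a" "0 < b" "0 < c" "0 < d" for a b c d
    using regroup[OF that] regroup[of a c b d] coc[of b c a] that
    by (simp add: add.commute add.left_commute)
  from this[of "x * u" "x * v" "y * u" "y * v"]
  have "\<bar>(G (x * u) (x * v) + G (y * u) (y * v) + G (x * (u + v)) (y * (u + v))) -
      (G (u * x) (u * y) + G (v * x) (v * y) + G (u * (x + y)) (v * (x + y)))\<bar> \<le> 7 * \<delta>"
    using pos by (simp add: algebra_simps)
  then have "\<bar>(x powr \<alpha> * G u v + y powr \<alpha> * G u v + G x y) -
      (u powr \<alpha> * G x y + v powr \<alpha> * G x y + G u v)\<bar> \<le> 7 * \<delta>"
    using pos by (simp add: sums hom)
  then show ?thesis
    by (simp add: algebra_simps)
qed

text \<open>The cocycle defect is treated first, because the identity that removes the symmetry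
  defect needs the cocycle equation to be exact.\<close>

lemma defects_vanish:
  fixes G :: "real \<Rightarrow> real \<Rightarrow> real"
  assumes "\<alpha> < 0" and "\<epsilon> \<ge> 0"
    and sym: "\<And>x z. 0 < x \<Longrightarrow> 0 < z \<Longrightarrow> \<bar>G z x - G x z\<bar> \<le> \<epsilon> * (x + z) powr \<alpha>"
    and coc: "\<And>x y z. 0 < x \<Longrightarrow> 0 < y \<Longrightarrow> 0 < z \<Longrightarrow>
      \<bar>G z x + G (z + x) y - G z y - G (z + y) x\<bar> \<le> \<epsilon> * (x + y + z) powr \<alpha>"
  shows "0 < x \<Longrightarrow> 0 < y \<Longrightarrow> 0 < z \<Longrightarrow> G z x + G (z + x) y - G z y - G (z + y) x = 0"
    and "0 < x \<Longrightarrow> 0 < z \<Longrightarrow> G z x - G x z = 0"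
proof -
  define E where "E x y z = G z x + G (z + x) y - G z y - G (z + y) x" for x y z
  define N where "N z x = G z x - G x z" for x z
  \<comment> \<open>As \<alpha> < 0, the bound decreases with the total mass, so every term of mass
    at least \<open>w\<close> is controlled by \<open>w powr \<alpha>\<close>.\<close>
  have mono: "\<epsilon> * s powr \<alpha> \<le> \<epsilon> * w powr \<alpha>" if "0 < w" "w \<le> s" for s w
    using that assms(1,2) by (intro mult_left_mono powr_mono2') auto
  have E_le: "\<bar>E x y z\<bar> \<le> \<epsilon> * w powr \<alpha>"
    if "0 < x" "0 < y" "0 < z" "0 < w" "w \<le> x + y + z" for x y z w
    using coc[of x y z] mono[of w "x + y + z"] that unfolding E_def by linarith
  have N_le: "\<bar>N z x\<bar> \<le> \<epsilon> * w powr \<alpha>" if "0 < x" "0 < z" "0 < w" "w \<le> x + z" for x z w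
    using sym[of x z] mono[of w "x + z"] that unfolding N_def by linarith
  have E_0: "E x y z = 0" if "0 < x" "0 < y" "0 < z" for x y z
  proof (rule eq_0_if_abs_le_powr[OF \<open>\<alpha> < 0\<close>, of _ "5 * \<epsilon>"])
    fix w :: real assume "0 < w"
    \<comment> \<open>\<open>E x y\<close> is the discrete curl of \<open>\<lambda>x z. G z x\<close>, so its own curl vanishes.\<close>
    have "E x y z = E x y (z + w) + E y w (z + x) - E y w z + E w x (z + y) - E w x z"
    proof -
      have "z + w + x = z + x + w" "z + w + y = z + y + w" "z + y + x = z + x + y" by simp_all
      then show ?thesis unfolding E_def by (simp only:)
    qed
    moreover have "\<bar>E x y (z + w)\<bar> \<le> \<epsilon> * w powr \<alpha>" "\<bar>E y w (z + x)\<bar> \<le> \<epsilon> * w powr \<alpha>"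
      "\<bar>E y w z\<bar> \<le> \<epsilon> * w powr \<alpha>" "\<bar>E w x (z + y)\<bar> \<le> \<epsilon> * w powr \<alpha>"
      "\<bar>E w x z\<bar> \<le> \<epsilon> * w powr \<alpha>"
      using that \<open>0 < w\<close> by (auto intro!: E_le)
    ultimately show "\<bar>E x y z\<bar> \<le> 5 * \<epsilon> * w powr \<alpha>"
      unfolding abs_le_iff by linarith
  qed
  show "G z x + G (z + x) y - G z y - G (z + y) x = 0" if "0 < x" "0 < y" "0 < z"
    using E_0[OF that] unfolding E_def .
  have "N z x = 0" if pos: "0 < x" "0 < z"
  proof (rule eq_0_if_abs_le_powr[OF \<open>\<alpha> < 0\<close>, of _ "2 * \<epsilon>"])
    fix w :: real assume "0 < w"
    \<comment> \<open>In three exact cocycle equations for \<open>x\<close>, \<open>z\<close>,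
      \<open>w\<close> the terms with summed arguments cancel, so \<open>N\<close> adds up to 0
      around the triangle.\<close>
    have "N z x = - N x w - N w z"
      using E_0[of x w z] E_0[of z w x] E_0[of x z w] pos \<open>0 < w\<close>
      unfolding E_def N_def by (simp add: add.commute)
    moreover have "\<bar>N x w\<bar> \<le> \<epsilon> * w powr \<alpha>" "\<bar>N w z\<bar> \<le> \<epsilon> * w powr \<alpha>"
      using pos \<open>0 < w\<close> by (auto intro!: N_le)
    ultimately show "\<bar>N z x\<bar> \<le> 2 * \<epsilon> * w powr \<alpha>"
      unfolding abs_le_iff by linarith
  qed
  then show "G z x - G x z = 0" if "0 < x" "0 < z" using that unfolding N_def .
qed

theorem theorem3p1:
  fixes \<alpha> \<epsilon> :: real and f :: "real \<Rightarrow> real"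
  assumes "\<alpha> \<le> 0" and "\<epsilon> \<ge> 0"
    and "\<forall>(x, y) \<in> D.
      \<bar>f x + (1 - x) powr \<alpha> * f (y / (1 - x))
        - f y - (1 - y) powr \<alpha> * f (x / (1 - y))\<bar> \<le> \<epsilon>"
  shows "(\<alpha> < 0 \<longrightarrow>
            (\<exists>a b. fei_solution \<alpha> (h1 \<alpha> a b) \<and>
                   (\<forall>x \<in> {0..1}. \<bar>f x - h1 \<alpha> a b x\<bar> \<le> 15 * \<epsilon>))) \<and>
         (\<alpha> = 0 \<longrightarrow>
            (\<exists>a b c. fei_solution \<alpha> (h2 a b c) \<and>
                     (\<forall>x \<in> {0..1}. \<bar>f x - h2 a b c x\<bar> \<le> 63 * \<epsilon>)))"
proof -
  have ineq: "\<bar>f x + (1 - x) powr \<alpha> * f (y / (1 - x)) - f y - (1 - y) powr \<alpha> * f (x / (1 - y))\<bar> \<le> \<epsilon>"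
    if "0 \<le> x" "x < 1" "0 \<le> y" "y < 1" "x + y \<le> 1" for x y
    using assms(3) that unfolding D_def by auto
  \<comment> \<open>The subtracted terms cancel in the cocycle expression, and they absorb the
    \<open>f 1\<close> terms that the edge \<open>x + y = 1\<close> produces.\<close>
  define G where "G z x = (x + z) powr \<alpha> * f (x / (x + z)) - f 1 * x powr \<alpha>" for z x
  have f_eq: "f x = G (1 - x) x + f 1 * x powr \<alpha>" for x
    by (simp add: G_def)
  have hom: "G (t * z) (t * x) = t powr \<alpha> * G z x" if "0 < t" "0 < x" "0 < z" for t x z
  proof -
    have "t * x + t * z = t * (x + z)" by (simp add: algebra_simps)
    then show ?thesis using that by (simp add: G_def powr_mult right_diff_distrib)
  qed
  \<comment> \<open>This is the edge instance at \<open>(x / s, z / s)\<close>, where both inner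
    arguments are 1, scaled by \<open>s powr \<alpha>\<close>.\<close>
  have sym: "\<bar>G z x - G x z\<bar> \<le> \<epsilon> * (x + z) powr \<alpha>" if "0 < x" "0 < z" for x z
  proof -
    define s where "s = x + z"
    have s: "0 < s" "1 - x / s = z / s" "1 - z / s = x / s"
      using that by (auto simp: s_def field_simps)
    have "\<bar>f (x / s) + (z / s) powr \<alpha> * f 1 - f (z / s) - (x / s) powr \<alpha> * f 1\<bar> \<le> \<epsilon>"
      using ineq[of "x / s" "z / s"] that s by (simp add: s_def field_simps)
    then have "s powr \<alpha> * \<bar>f (x / s) + (z / s) powr \<alpha> * f 1 - f (z / s) - (x / s) powr \<alpha> * f 1\<bar>
        \<le> s powr \<alpha> * \<epsilon>"
      by (intro mult_left_mono) auto
    moreover have "G z x - G x z =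
        s powr \<alpha> * (f (x / s) + (z / s) powr \<alpha> * f 1 - f (z / s) - (x / s) powr \<alpha> * f 1)"
      using that s(1) by (simp add: G_def s_def powr_divide add.commute algebra_simps)
    ultimately show ?thesis by (simp add: abs_mult s_def mult.commute)
  qed
  \<comment> \<open>This is the interior instance at \<open>(x / s, y / s)\<close>, with
    \<open>z\<close> as the remaining mass, scaled by \<open>s powr \<alpha>\<close>.\<close>
  have coc: "\<bar>G z x + G (z + x) y - G z y - G (z + y) x\<bar> \<le> \<epsilon> * (x + y + z) powr \<alpha>"
    if "0 < x" "0 < y" "0 < z" for x y z
  proof -
    define s where "s = x + y + z"
    have s: "0 < s" "1 - x / s = (y + z) / s" "1 - y / s = (x + z) / s"
      using that by (auto simp: s_def field_simps)
    let ?e = "f (x / s) + ((y + z) / s) powr \<alpha> * f (y / (y + z))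
      - f (y / s) - ((x + z) / s) powr \<alpha> * f (x / (x + z))"
    have "x / s < 1" "y / s < 1" "x / s + y / s \<le> 1"
      using that by (auto simp: s_def simp flip: add_divide_distrib)
    then have "\<bar>?e\<bar> \<le> \<epsilon>"
      using ineq[of "x / s" "y / s"] that s by simp
    then have "s powr \<alpha> * \<bar>?e\<bar> \<le> s powr \<alpha> * \<epsilon>"
      by (intro mult_left_mono) auto
    moreover have "G z x + G (z + x) y - G z y - G (z + y) x = - (s powr \<alpha> * ?e)"
    proof -
      have "y + (z + x) = s" "x + (z + y) = s" by (auto simp: s_def)
      then show ?thesis
        using that s(1) by (simp add: G_def powr_divide algebra_simps)
    qed
    ultimately show ?thesis by (simp add: abs_mult s_def mult.commute)
  qed
  show ?thesis
  proof (intro conjI impI)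
    assume neg: "\<alpha> < 0"
    note zero = defects_vanish[OF neg assms(2) sym coc]
    \<comment> \<open>\<open>p\<close> is the factor of the product rule at
      \<open>u = v = 1 / 2\<close>; it is negative since \<open>(1 / 2) powr \<alpha> > 1\<close>.
      Dividing by it solves for \<open>G (1 - x) x\<close>.\<close>
    define p where "p = 1 - 2 * (1 / 2) powr \<alpha>"
    define c where "c = G (1 / 2) (1 / 2) / p"
    have "(1 / 2) powr \<alpha> > (1 / 2 :: real) powr 0"
      using neg by (intro powr_less_mono') auto
    then have "p \<noteq> 0" by (simp add: p_def)
    have interior: "f x = (f 1 - c) * x powr \<alpha> + (- c) * (1 - x) powr \<alpha> - (- c)"
      if "0 < x" "x < 1" for x
    proof -
      have "\<bar>G (1 - x) x * (1 - (1 / 2) powr \<alpha> - (1 / 2) powr \<alpha>)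
          - G (1 / 2) (1 / 2) * (1 - (1 - x) powr \<alpha> - x powr \<alpha>)\<bar> \<le> 7 * 0"
        by (rule product_rule_defect) (simp_all add: zero hom that)
      then have "G (1 - x) x * p = G (1 / 2) (1 / 2) * (1 - (1 - x) powr \<alpha> - x powr \<alpha>)"
        by (simp add: p_def)
      then have "G (1 - x) x = c * (1 - (1 - x) powr \<alpha> - x powr \<alpha>)"
        using \<open>p \<noteq> 0\<close> by (simp add: c_def field_simps)
      then show ?thesis using f_eq[of x] by (simp add: algebra_simps)
    qed
    \<comment> \<open>At \<open>x = 0\<close> the hypothesis bounds
      \<open>f 0 * (1 - (1 - y) powr \<alpha>)\<close>, whose second factor is unbounded as
      \<open>y\<close> tends to 1. Putting \<open>y = 1 - 1 / w\<close>, which needs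
      \<open>w\<close> at least 1, gives the decay in \<open>w\<close>; for small \<open>w\<close>
      the bound is trivial.\<close>
    have "f 0 = 0"
    proof (rule eq_0_if_abs_le_powr[OF neg, of _ "\<epsilon> + \<bar>f 0\<bar>"])
      fix w :: real assume "0 < w"
      show "\<bar>f 0\<bar> \<le> (\<epsilon> + \<bar>f 0\<bar>) * w powr \<alpha>"
      proof (cases "w \<le> 1")
        case True
        then have "1 \<le> w powr \<alpha>"
          using \<open>0 < w\<close> neg powr_mono2'[of \<alpha> w 1] by simp
        then have "\<bar>f 0\<bar> * 1 \<le> (\<epsilon> + \<bar>f 0\<bar>) * w powr \<alpha>"
          using assms(2) by (intro mult_mono) auto
        then show ?thesis by simp
      next
        case False
        then have "\<bar>f 0 * (1 - (1 / w) powr \<alpha>)\<bar> \<le> \<epsilon>"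
          using ineq[of 0 "1 - 1 / w"] by (simp add: algebra_simps)
        then have "\<bar>f 0 * (1 - (1 / w) powr \<alpha>)\<bar> * w powr \<alpha> \<le> \<epsilon> * w powr \<alpha>"
          by (intro mult_right_mono) auto
        moreover have "\<bar>f 0 * (1 - (1 / w) powr \<alpha>)\<bar> * w powr \<alpha> = \<bar>f 0 * w powr \<alpha> - f 0\<bar>"
        proof -
          have "\<bar>f 0 * (1 - (1 / w) powr \<alpha>)\<bar> * w powr \<alpha> =
              \<bar>f 0 * (1 - (1 / w) powr \<alpha>) * w powr \<alpha>\<bar>"
            by (simp add: abs_mult)
          also have "f 0 * (1 - (1 / w) powr \<alpha>) * w powr \<alpha> = f 0 * w powr \<alpha> - f 0"
            using \<open>0 < w\<close> by (simp add: powr_divide field_simps)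
          finally show ?thesis .
        qed
        moreover have "\<bar>f 0 * w powr \<alpha>\<bar> = \<bar>f 0\<bar> * w powr \<alpha>" by (simp add: abs_mult)
        ultimately show ?thesis unfolding distrib_right by linarith
      qed
    qed
    \<comment> \<open>In each case \<open>f\<close> agrees with \<open>h1\<close> exactly, so the
      difference is 0.\<close>
    have "\<bar>f x - h1 \<alpha> (f 1 - c) (- c) x\<bar> \<le> 15 * \<epsilon>" if x: "x \<in> {0..1}" for x
    proof -
      consider "x = 0" | "x = 1" | "0 < x" "x < 1" using x by fastforce
      then show ?thesis
      proof cases
        case 3
        then show ?thesis unfolding interior[OF 3] h1_def using assms(2) by simp
      qed (simp_all add: h1_def \<open>f 0 = 0\<close> assms(2))
    qed
    then show "\<exists>a b. fei_solution \<alpha> (h1 \<alpha> a b) \<and> (\<forall>x \<in> {0..1}. \<bar>f x - h1 \<alpha> a b x\<bar> \<le> 15 * \<epsilon>)"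
      using fei_solution_h1 by blast
  next
    assume "\<alpha> = 0"
    then have sym0: "\<bar>G z x - G x z\<bar> \<le> \<epsilon>" if "0 < x" "0 < z" for x z
      using sym[OF that] that by simp
    have coc0: "\<bar>G z x + G (z + x) y - G z y - G (z + y) x\<bar> \<le> \<epsilon>"
      if "0 < x" "0 < y" "0 < z" for x y z
      using coc[OF that] that \<open>\<alpha> = 0\<close> by simp
    \<comment> \<open>For \<alpha> = 0 both factors in the product rule are
      \<open>1 - 1 - 1 = -1\<close>, and \<open>G (1 - x) x\<close> is \<open>f x - f 1\<close>, so
      \<open>f 1\<close> cancels.\<close>
    have near: "\<bar>f x - f (1 / 2)\<bar> \<le> 7 * \<epsilon>" if "0 < x" "x < 1" for x
    proof -
      have "\<bar>G (1 - x) x * (1 - (1 / 2) powr \<alpha> - (1 / 2) powr \<alpha>)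
          - G (1 / 2) (1 / 2) * (1 - (1 - x) powr \<alpha> - x powr \<alpha>)\<bar> \<le> 7 * \<epsilon>"
        by (rule product_rule_defect[OF sym0 coc0 hom]) (use that in auto)
      then show ?thesis
        using f_eq[of x] f_eq[of "1 / 2"] that \<open>\<alpha> = 0\<close> by auto
    qed
    \<comment> \<open>The endpoint values are matched exactly; only the open interval contributes an
      error.\<close>
    have "\<bar>f x - h2 (f 0) (f 1) (f (1 / 2)) x\<bar> \<le> 63 * \<epsilon>" if "x \<in> {0..1}" for x
      using near[of x] that assms(2) by (auto simp: h2_def)
    then show "\<exists>a b c. fei_solution \<alpha> (h2 a b c) \<and> (\<forall>x \<in> {0..1}. \<bar>f x - h2 a b c x\<bar> \<le> 63 * \<epsilon>)"
      using fei_solution_h2 \<open>\<alpha> = 0\<close> by blast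
  qed
qed

end
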